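(* Let $I\subseteq S$ be a proper monomial ideal and let $\mathbf a\succeq\mathbf a_I$. Then $(I^{\mathbf a})^{\mathbf a}=I$. Furthermore, $(\mathbf b^{\mathbf a})^{\mathbf a}=\mathbf b$ for all $\mathbf 0\preceq\mathbf b\preceq\mathbf a$, so that $$I^{\mathbf a}=\bigcap\{\mathfrak m^{\mathbf b^{\mathbf a}}\mid x^{\mathbf b}\text{ is a minimal generator of } I\}.$$
   Context: $k$ is a field, $n\ge 2$, $S=k[x_1,\ldots,x_n]$, $x^{\mathbf a}=x_1^{a_1}\cdots x_n^{a_n}$, and $\preceq$ is the coordinatewise partial order on $\mathbb Z^n$. For $\mathbf b\in\mathbb N^n$ put $\mathfrak m^{\mathbf b}=\langle x_i^{b_i}\mid b_i\ge 1\rangle$; these are exactly the irreducible monomial ideals. $\mathbf a_I$ is the exponent vector of the least common multiple of the minimal generators of $I$, and $\mathrm{Irr}(I)$ is the set of irreducible components in the unique irredundant decomposition of $I$ as an intersection of irreducible monomial ideals; $\mathfrak m^{\mathbf b}\in\mathrm{Irr}(I)$ implies $\mathbf b\preceq\mathbf a_I$. For $\mathbf 0\preceq\mathbf b\preceq\mathbf a$ let $\mathbf b^{\mathbf a}$ be the vector with $i$th coordinate $a_i+1-b_i$ if $b_i\ge1$ and $0$ if $b_i=0$. For $\mathbf a\succeq\mathbf a_I$ the Alexander dual ideal of $I$ with respect to $\mathbf a$ is $I^{\mathbf a}=\langle x^{\mathbf b^{\mathbf a}}\mid \mathfrak m^{\mathbf b}\in\mathrm{Irr}(I)\rangle$.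 (One has $\mathbf a_{I^{\mathbf a}}\preceq\mathbf a$, so $(I^{\mathbf a})^{\mathbf a}$ is defined.) *)

theory Defs
  imports Complex_Main "HOL-Library.Poly_Mapping" "HOL-Library.Cardinality"
begin

text \<open>
  The polynomial ring \<open>k[x\<^sub>1,\<dots>,x\<^sub>n]\<close>: the \<open>n\<close> variables are indexed by a finite type \<open>'n\<close> and
  the polynomials form the monoid algebra over \<open>'k\<close> of the finitely supported maps from \<open>'n\<close>
  to \<open>nat\<close>. Exponent vectors in \<open>\<nat>\<^sup>n\<close> appear below as plain functions from \<open>'n\<close> to \<open>nat\<close>, so that
  \<open>\<le>\<close> on them is the coordinatewise order.
\<close>

type_synonym ('n, 'k) mpoly = "('n \<Rightarrow>\<^sub>0 nat) \<Rightarrow>\<^sub>0 'k"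

definition Var :: "'n \<Rightarrow> ('n, 'k::field) mpoly" where
  "Var i = Poly_Mapping.single (Poly_Mapping.single i 1) 1"

definition mono_of :: "('n::finite \<Rightarrow> nat) \<Rightarrow> ('n, 'k::field) mpoly" where
  "mono_of b = (\<Prod>i\<in>UNIV. Var i ^ b i)"

text \<open>
  Ideals of a commutative ring are the submodules of the ring over itself: \<open>ideal.subspace I\<close>
  says that \<open>I\<close> is an ideal, and \<open>ideal.span B\<close> is the ideal generated by \<open>B\<close>.
\<close>

global_interpretation ideal: module "(*) :: 'a::comm_ring_1 \<Rightarrow> 'a \<Rightarrow> 'a"
  by unfold_locales (simp_all add: algebra_simps)

definition monomial_ideal :: "('n::finite, 'k::field) mpoly set \<Rightarrow> bool" where
  "monomial_ideal I \<longleftrightarrow> (\<exists>M \<subseteq> range mono_of. I = ideal.span M)"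

definition irreducible_ideal :: "'a::comm_ring_1 set \<Rightarrow> bool" where
  "irreducible_ideal I \<longleftrightarrow> ideal.subspace I \<and> I \<noteq> UNIV \<and>
     (\<forall>J K. ideal.subspace J \<longrightarrow> ideal.subspace K \<longrightarrow> I = J \<inter> K \<longrightarrow> I = J \<or> I = K)"

text \<open>The ideal \<open>\<mm>\<^sup>b\<close>; for \<open>b = 0\<close> it is the zero ideal.\<close>

definition var_power_ideal :: "('n::finite \<Rightarrow> nat) \<Rightarrow> ('n, 'k::field) mpoly set" where
  "var_power_ideal b = ideal.span {Var i ^ b i | i. b i \<ge> 1}"

text \<open>The inclusion-minimal set of monomials generating \<open>I\<close>, unique when \<open>I\<close> is a monomial ideal.\<close>

definition min_gens :: "('n::finite, 'k::field) mpoly set \<Rightarrow> ('n, 'k) mpoly set" where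
  "min_gens I = (THE G. G \<subseteq> range mono_of \<and> ideal.span G = I \<and>
     (\<forall>H. H \<subset> G \<longrightarrow> ideal.span H \<noteq> I))"

text \<open>
  The exponent vector \<open>a\<^sub>I\<close>: the exponent of a variable in a least common multiple of monomials is
  the maximum of its exponents. By Dickson's lemma the set of minimal generators is finite. The
  inserted \<open>0\<close> only matters for the zero ideal, where the empty least common multiple is \<open>1\<close>.
\<close>

definition lcm_exponent :: "('n::finite, 'k::field) mpoly set \<Rightarrow> 'n \<Rightarrow> nat" where
  "lcm_exponent I = (\<lambda>i. Max (insert 0 {b i | b. mono_of b \<in> min_gens I}))"

text \<open>
  The unit ideal is the empty intersection, so it has no irreducible components; this case does
  occur as the Alexander dual of the zero ideal.
\<close>

definition irredundant_irr_decomp ::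
  "('n::finite, 'k::field) mpoly set \<Rightarrow> ('n, 'k) mpoly set set \<Rightarrow> bool" where
  "irredundant_irr_decomp I D \<longleftrightarrow> finite D \<and>
     (\<forall>J\<in>D. monomial_ideal J \<and> irreducible_ideal J) \<and>
     \<Inter>D = I \<and> (\<forall>J\<in>D. \<Inter>(D - {J}) \<noteq> I)"

definition Irr :: "('n::finite, 'k::field) mpoly set \<Rightarrow> ('n, 'k) mpoly set set" where
  "Irr I = (THE D. irredundant_irr_decomp I D)"

text \<open>
  The vector \<open>b\<^sup>a\<close>, meant for \<open>b \<le> a\<close>; then the subtraction does not truncate.
\<close>

definition dual_vec :: "('n \<Rightarrow> nat) \<Rightarrow> ('n \<Rightarrow> nat) \<Rightarrow> 'n \<Rightarrow> nat" where
  "dual_vec a b = (\<lambda>i. if b i \<ge> 1 then a i + 1 - b i else 0)"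

text \<open>The Alexander dual \<open>I\<^sup>a\<close>, meant for monomial ideals \<open>I\<close> with \<open>lcm_exponent I \<le> a\<close>.\<close>

definition alexander_dual ::
  "('n::finite \<Rightarrow> nat) \<Rightarrow> ('n, 'k::field) mpoly set \<Rightarrow> ('n, 'k) mpoly set" where
  "alexander_dual a I = ideal.span {mono_of (dual_vec a b) | b. var_power_ideal b \<in> Irr I}"

end

theory Submission
  imports Defs "HOL-Library.FuncSet"
begin

text \<open>
  A monomial ideal is the span of the monomials it contains, so it is determined by an up-set
  \<open>U\<close> of \<open>\<nat>\<^sup>n\<close>; intersections of ideals become intersections of up-sets. If \<open>a\<close> bounds the minimal
  elements of \<open>U\<close>, then replacing \<open>u\<close> by the coordinatewise minimum of \<open>u\<close> and \<open>a\<close> does not change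
  membership in \<open>U\<close>, and only the part of \<open>U\<close> in the box \<open>[0, a]\<close> matters.

  In this box the dual is complementation followed by reflection: for \<open>w \<le> a\<close>,
  \<open>x\<^sup>w \<in> I\<^sup>a\<close> if and only if \<open>x\<close> to the power \<open>a - w\<close> is not in \<open>I\<close>. Indeed \<open>w\<close> lies above the
  generator \<open>b\<^sup>a\<close> exactly when \<open>a - w\<close> is outside the component \<open>\<mm>\<^sup>b\<close> (\<open>dual_vec_le_iff\<close>), and \<open>I\<close>
  is the intersection of its components. The two operations are commuting involutions, hence so is the dual.
  Read from the other side, \<open>x\<^sup>w\<close> lies in the irreducible ideal with vector \<open>b\<^sup>a\<close> exactly when
  \<open>a - w\<close> is not above \<open>b\<close> (\<open>mem_power_exponents_dual_iff\<close>), and letting \<open>b\<close> run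
  through the minimal generators of \<open>I\<close> gives the formula for \<open>I\<^sup>a\<close> as an intersection.

  It remains to know that \<open>Irr I\<close> and \<open>min_gens I\<close>, which are definite descriptions, denote the
  expected objects. The generators are the monomials with minimal exponents, and by Dickson's lemma
  (\<open>finite_minimals\<close>) they are finite in number, so that \<open>a\<^sub>I\<close> bounds their exponents. For the
  components it needs three things: the finitely many \<open>\<mm>\<^sup>b\<close> with \<open>b \<le> a\<close> that contain \<open>I\<close> intersect
  in \<open>I\<close> (\<open>up_set_eq_Inter_power_exponents\<close>); each \<open>\<mm>\<^sup>b\<close> is irreducible as an ideal, not only
  among monomial ideals (\<open>irreducible_var_power_ideal\<close>); and \<open>\<mm>\<^sup>b\<close> behaves like a prime element of
  the lattice of up-sets (\<open>power_exponents_prime\<close>), which gives uniqueness.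
\<close>

section \<open>Up-sets of exponent vectors\<close>

definition up_set :: "('n \<Rightarrow> nat) set \<Rightarrow> bool" where
  "up_set U \<longleftrightarrow> (\<forall>u\<in>U. \<forall>v. u \<le> v \<longrightarrow> v \<in> U)"

definition up_closure :: "('n \<Rightarrow> nat) set \<Rightarrow> ('n \<Rightarrow> nat) set" where
  "up_closure B = {u. \<exists>b\<in>B. b \<le> u}"

definition minimals :: "('n \<Rightarrow> nat) set \<Rightarrow> ('n \<Rightarrow> nat) set" where
  "minimals U = {u\<in>U. \<forall>v\<in>U. v \<le> u \<longrightarrow> v = u}"

text \<open>
  The exponents of the monomials in \<open>\<mm>\<^sup>b\<close>.
\<close>

definition power_exponents :: "('n \<Rightarrow> nat) \<Rightarrow> ('n \<Rightarrow> nat) set" where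
  "power_exponents b = {u. \<exists>i. 1 \<le> b i \<and> b i \<le> u i}"

lemma up_setD: "up_set U \<Longrightarrow> u \<in> U \<Longrightarrow> u \<le> v \<Longrightarrow> v \<in> U"
  by (auto simp: up_set_def)

lemma up_set_up_closure: "up_set (up_closure B)"
  unfolding up_set_def up_closure_def by (blast intro: order_trans)

lemma up_set_power_exponents: "up_set (power_exponents b)"
  unfolding up_set_def power_exponents_def le_fun_def
  by (auto intro: order_trans)

lemma not_mem_power_exponents_iff:
  "u \<notin> power_exponents b \<longleftrightarrow> (\<forall>i. 1 \<le> b i \<longrightarrow> u i < b i)"
  unfolding power_exponents_def not_le[symmetric] by blast

text \<open>
  Coordinatewise descent in \<open>\<nat>\<^sup>n\<close> ends, because it decreases the sum of the coordinates.
\<close>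

lemma minimals_below:
  fixes u :: "'n::finite \<Rightarrow> nat"
  assumes "u \<in> U"
  obtains v where "v \<in> minimals U" "v \<le> u"
proof -
  have "\<exists>v \<in> minimals U. v \<le> u" using assms
  proof (induction "\<Sum>i\<in>UNIV. u i" arbitrary: u rule: less_induct)
    case less
    show ?case
    proof (cases "u \<in> minimals U")
      case False
      then obtain v where v: "v \<in> U" "v \<le> u" "v \<noteq> u"
        using less.prems by (auto simp: minimals_def)
      then obtain i where "v i < u i"
        by (metis le_fun_def le_neq_implies_less ext)
      then have "sum v UNIV < sum u UNIV"
        using v(2) by (intro sum_strict_mono_ex1) (auto simp: le_fun_def)
      with less.hyps v(1) obtain w where "w \<in> minimals U" "w \<le> v" by blast
      with v(2) show ?thesis by (blast intro: order_trans)
    qed auto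
  qed
  then show ?thesis using that by blast
qed

lemma up_closure_minimals:
  fixes U :: "('n::finite \<Rightarrow> nat) set"
  assumes "up_set U"
  shows "up_closure (minimals U) = U"
proof
  show "up_closure (minimals U) \<subseteq> U"
    using assms by (auto simp: up_closure_def up_set_def minimals_def)
  show "U \<subseteq> up_closure (minimals U)"
  proof
    fix u assume "u \<in> U"
    then obtain v where "v \<in> minimals U" "v \<le> u" using minimals_below by blast
    then show "u \<in> up_closure (minimals U)" by (auto simp: up_closure_def)
  qed
qed

lemma minimals_up_closure_subset: "minimals (up_closure B) \<subseteq> B"
proof
  fix u assume u: "u \<in> minimals (up_closure B)"
  then obtain b where b: "b \<in> B" "b \<le> u" by (auto simp: minimals_def up_closure_def)
  then have "b \<in> up_closure B" by (auto simp: up_closure_def)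
  with u b(2) have "b = u" by (auto simp: minimals_def)
  with b show "u \<in> B" by simp
qed

text \<open>
  A monotone subsequence always exists; if it decreases, it becomes constant from the index where
  its minimum is attained, and its tail from there on is increasing as well.
\<close>

lemma incseq_subseq_nat:
  fixes s :: "nat \<Rightarrow> nat"
  obtains r where "strict_mono r" "incseq (s \<circ> r)"
proof -
  obtain r where r: "strict_mono r" "monoseq (\<lambda>n. s (r n))"
    using seq_monosub by blast
  show ?thesis
  proof (cases "incseq (s \<circ> r)")
    case False
    then have dec: "n \<ge> m \<Longrightarrow> s (r n) \<le> s (r m)" for m n
      using r(2) by (auto simp: monoseq_def incseq_def)
    define m where "m = (ARG_MIN (\<lambda>n. s (r n)) n. True)"
    have min: "s (r m) \<le> s (r n)" for n
      unfolding m_def by (rule arg_min_nat_le) simp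
    have const: "s (r (m + n)) = s (r m)" for n
      using dec[of m "m + n"] min[of "m + n"] by simp
    have "strict_mono (\<lambda>n. r (m + n))"
      using r(1) by (auto simp: strict_mono_def)
    moreover have "incseq (s \<circ> (\<lambda>n. r (m + n)))"
      by (simp add: incseq_def const)
    ultimately show ?thesis using that by blast
  qed (use r that in blast)
qed

lemma incseq_subseq_coordinates:
  fixes f :: "nat \<Rightarrow> 'n \<Rightarrow> nat"
  assumes "finite X"
  shows "\<exists>r. strict_mono r \<and> (\<forall>i\<in>X. incseq (\<lambda>n. f (r n) i))"
  using assms
proof induction
  case empty
  then show ?case by (auto intro: strict_mono_id)
next
  case (insert x X)
  then obtain r where r: "strict_mono r" "\<forall>i\<in>X. incseq (\<lambda>n. f (r n) i)" by blast
  obtain t where t: "strict_mono t" "incseq ((\<lambda>n. f (r n) x) \<circ> t)"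
    using incseq_subseq_nat by blast
  have "strict_mono (r \<circ> t)" using r t by (simp add: strict_mono_o)
  moreover have "\<forall>i\<in>insert x X. incseq (\<lambda>n. f ((r \<circ> t) n) i)"
    using r(2) t by (auto simp: incseq_def strict_mono_less_eq)
  ultimately show ?case by blast
qed

text \<open>
  Dickson's lemma: an injective sequence of minimal elements would have a subsequence that
  increases in every coordinate, but distinct minimal elements are incomparable.
\<close>

lemma finite_minimals:
  fixes U :: "('n::finite \<Rightarrow> nat) set"
  shows "finite (minimals U)"
proof (rule ccontr)
  assume "infinite (minimals U)"
  then obtain f :: "nat \<Rightarrow> 'n \<Rightarrow> nat" where f: "inj f" "range f \<subseteq> minimals U"
    using infinite_countable_subset by blast
  obtain r where r: "strict_mono r" "\<forall>i. incseq (\<lambda>n. f (r n) i)"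
    using incseq_subseq_coordinates[of UNIV f] by auto
  have "f (r 0) \<le> f (r 1)" using r(2) by (auto simp: le_fun_def incseq_def)
  moreover have "f (r 0) \<in> minimals U" "f (r 1) \<in> minimals U" using f by auto
  ultimately have "f (r 0) = f (r 1)" by (auto simp: minimals_def)
  then show False using f(1) r(1) by (metis injD strict_mono_eq zero_neq_one)
qed

text \<open>
  If \<open>u\<close> lies above a minimal element, which is below \<open>a\<close>, then so does the minimum of \<open>u\<close> and \<open>a\<close>.
\<close>

lemma truncate_mem:
  fixes U :: "('n::finite \<Rightarrow> nat) set"
  assumes "up_set U" "minimals U \<subseteq> {..a}"
  shows "inf u a \<in> U \<longleftrightarrow> u \<in> U"
proof
  assume "u \<in> U"
  then obtain v where "v \<in> minimals U" "v \<le> u" using minimals_below by blast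
  moreover from this have "v \<in> U" "v \<le> inf u a" using assms(2) by (auto simp: minimals_def)
  ultimately show "inf u a \<in> U" using assms(1) up_setD by blast
qed (use assms up_setD[of U "inf u a" u] in auto)

lemma truncate_mem_power_exponents:
  "b \<le> a \<Longrightarrow> inf w a \<in> power_exponents b \<longleftrightarrow> w \<in> power_exponents b"
  unfolding power_exponents_def le_fun_def by (auto simp: inf_min)

text \<open>
  A point \<open>u\<close> outside \<open>U\<close> is separated from \<open>U\<close> by the vector \<open>b\<close> that has the entry \<open>u i + 1\<close> where
  \<open>u\<close> is below \<open>a\<close> and no condition elsewhere: whatever avoids \<open>power_exponents b\<close> is below \<open>u\<close> after
  truncation at \<open>a\<close>, hence outside \<open>U\<close>.
\<close>

lemma up_set_eq_Inter_power_exponents: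
  fixes U :: "('n::finite \<Rightarrow> nat) set"
  assumes "up_set U" "minimals U \<subseteq> {..a}"
  shows "U = \<Inter>(power_exponents ` {b. b \<le> a \<and> U \<subseteq> power_exponents b})"
proof (rule antisym[OF _ subsetI])
  fix u assume u: "u \<in> \<Inter>(power_exponents ` {b. b \<le> a \<and> U \<subseteq> power_exponents b})"
  show "u \<in> U"
  proof (rule ccontr)
    assume "u \<notin> U"
    define b where "b = (\<lambda>i. if u i < a i then u i + 1 else 0)"
    have "U \<subseteq> power_exponents b"
    proof
      fix v assume "v \<in> U"
      show "v \<in> power_exponents b"
      proof (rule ccontr)
        assume "v \<notin> power_exponents b"
        then have not: "1 \<le> b i \<Longrightarrow> v i < b i" for i
          by (simp only: not_mem_power_exponents_iff)
        have "inf v a i \<le> u i" for i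
          using not[of i] by (cases "u i < a i") (auto simp: b_def inf_min)
        then have "inf v a \<le> u" by (simp add: le_fun_def)
        then show False
          using \<open>v \<in> U\<close> \<open>u \<notin> U\<close> assms truncate_mem up_setD by blast
      qed
    qed
    moreover have "b \<le> a" by (auto simp: b_def le_fun_def)
    ultimately have "u \<in> power_exponents b" using u by blast
    then show False by (auto simp: power_exponents_def b_def split: if_splits)
  qed
qed auto

text \<open>
  The complement of \<open>power_exponents b\<close> is closed under coordinatewise maxima. If no member of \<open>D\<close> were
  contained in \<open>power_exponents b\<close>, the maximum of one witness per member would lie in every member of
  \<open>D\<close> and still outside \<open>power_exponents b\<close>. For empty \<open>D\<close> this maximum is the zero vector, which is
  why \<open>0\<close> is inserted below.
\<close>

lemma power_exponents_prime:
  fixes b :: "'n::finite \<Rightarrow> nat"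
  assumes "finite D" "\<forall>U\<in>D. up_set U" "\<Inter>D \<subseteq> power_exponents b"
  shows "\<exists>U\<in>D. U \<subseteq> power_exponents b"
proof (rule ccontr)
  assume "\<not> ?thesis"
  then have "\<forall>U\<in>D. \<exists>u. u \<in> U \<and> u \<notin> power_exponents b" by blast
  then obtain u where u: "U \<in> D \<Longrightarrow> u U \<in> U \<and> u U \<notin> power_exponents b" for U
    by metis
  define v where "v = (\<lambda>i. Max (insert 0 ((\<lambda>U. u U i) ` D)))"
  have "u U \<le> v" if "U \<in> D" for U
    unfolding v_def le_fun_def using that assms(1) by auto
  then have "v \<in> \<Inter>D" using u assms(2) by (blast intro: up_setD)
  then have "v \<in> power_exponents b" using assms(3) by blast
  then obtain i where i: "1 \<le> b i" "b i \<le> v i" by (auto simp: power_exponents_def)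
  have "v i \<in> insert 0 ((\<lambda>U. u U i) ` D)"
    unfolding v_def using assms(1) by (intro Max_in) auto
  with i obtain U where "U \<in> D" "b i \<le> u U i" by auto
  with u i show False by (auto simp: power_exponents_def)
qed

text \<open>
  The entry \<open>b i\<close>, if positive, is the least exponent of a power of the \<open>i\<close>-th variable in \<open>\<mm>\<^sup>b\<close>.
\<close>

lemma power_exponents_eq_iff: "power_exponents b = power_exponents c \<longleftrightarrow> b = c"
proof -
  have *: "1 \<le> c i \<and> c i \<le> b i" if "power_exponents b = power_exponents c" "1 \<le> b i"
    for b c :: "'a \<Rightarrow> nat" and i
  proof -
    have "(\<lambda>_. 0)(i := b i) \<in> power_exponents b"
      using that(2) by (auto simp: power_exponents_def)
    then have "(\<lambda>_. 0)(i := b i) \<in> power_exponents c" using that(1) by simp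
    then show ?thesis
      by (fastforce simp: power_exponents_def split: if_splits)
  qed
  show ?thesis
  proof
    assume eq: "power_exponents b = power_exponents c"
    have "b i = c i" for i
      using *[OF eq, of i] *[OF eq[symmetric], of i] by linarith
    then show "b = c" by auto
  qed simp
qed

section \<open>Duality in the box below \<open>a\<close>\<close>

lemma dual_vec_le: "dual_vec a b \<le> a"
  by (auto simp: dual_vec_def le_fun_def)

lemma dual_vec_dual_vec: "b \<le> a \<Longrightarrow> dual_vec a (dual_vec a b) = b"
proof
  fix i assume "b \<le> a"
  then have "b i \<le> a i" by (simp add: le_fun_def)
  then show "dual_vec a (dual_vec a b) i = b i"
    by (simp add: dual_vec_def) arith
qed

text \<open>
  The heart of the duality, one coordinate at a time: for \<open>1 \<le> b i \<le> a i\<close> the inequality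
  \<open>a i + 1 - b i \<le> w i\<close> says \<open>a i - w i < b i\<close>, and for \<open>b i = 0\<close> neither side imposes a condition.
\<close>

lemma dual_vec_le_iff:
  assumes "b \<le> a" "w \<le> a"
  shows "dual_vec a b \<le> w \<longleftrightarrow> a - w \<notin> power_exponents b"
proof -
  have "dual_vec a b i \<le> w i \<longleftrightarrow> \<not> (1 \<le> b i \<and> b i \<le> a i - w i)" for i
    using assms[unfolded le_fun_def, rule_format, of i] by (auto simp: dual_vec_def)
  then show ?thesis by (simp add: le_fun_def power_exponents_def)
qed

lemma mem_power_exponents_dual_iff:
  assumes "b \<le> a" "w \<le> a"
  shows "w \<in> power_exponents (dual_vec a b) \<longleftrightarrow> \<not> b \<le> a - w"
proof -
  have "a - (a - w) = w" using assms(2) by (auto simp: le_fun_def)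
  moreover have "a - w \<le> a" by (auto simp: le_fun_def)
  ultimately show ?thesis
    using dual_vec_le_iff[OF dual_vec_le[of a b], of "a - w"] assms(1)
    by (simp add: dual_vec_dual_vec)
qed

section \<open>Monomial ideals as spaces of polynomials\<close>

text \<open>
  Exponent vectors occur in two forms: as keys of polynomials, which are finitely supported maps,
  and as plain functions; the function \<open>lookup\<close> turns the first form into the second.
\<close>

abbreviation lookup :: "('a \<Rightarrow>\<^sub>0 'b::zero) \<Rightarrow> 'a \<Rightarrow> 'b" where
  "lookup \<equiv> Poly_Mapping.lookup"

abbreviation keys :: "('a \<Rightarrow>\<^sub>0 'b::zero) \<Rightarrow> 'a set" where
  "keys \<equiv> Poly_Mapping.keys"

definition monomial_span :: "('n \<Rightarrow> nat) set \<Rightarrow> ('n, 'k::field) mpoly set" where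
  "monomial_span U = {f. \<forall>m\<in>keys f. lookup m \<in> U}"

lemma lookup_Abs_finite [simp]: "lookup (Abs_poly_mapping b) = (b :: 'n::finite \<Rightarrow> nat)"
  by (simp add: lookup_Abs_poly_mapping)

lemma Var_power: "Var i ^ k = Poly_Mapping.single (Poly_Mapping.single i k) 1"
  by (induction k) (simp_all add: Var_def mult_single flip: single_add)

lemma mono_of_eq_single:
  "(mono_of b :: ('n::finite, 'k::field) mpoly) = Poly_Mapping.single (Abs_poly_mapping b) 1"
proof -
  have "(\<Prod>i\<in>X. Poly_Mapping.single (g i) 1)
      = (Poly_Mapping.single (\<Sum>i\<in>X. g i) 1 :: ('n, 'k) mpoly)"
    if "finite X" for X :: "'n set" and g
    using that by induction (simp_all add: mult_single)
  moreover have "(\<Sum>i\<in>UNIV. Poly_Mapping.single i (b i)) = Abs_poly_mapping b"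
    by (rule poly_mapping_eqI) (simp add: lookup_sum lookup_single when_def)
  ultimately show ?thesis by (simp add: mono_of_def Var_power)
qed

lemma Var_power_eq_mono_of: "Var i ^ k = mono_of ((\<lambda>_. 0)(i := k))"
proof -
  have "Poly_Mapping.single i k = Abs_poly_mapping ((\<lambda>_. 0)(i := k))"
    by (rule poly_mapping_eqI) (simp add: lookup_single when_def)
  then show ?thesis by (simp add: Var_power mono_of_eq_single)
qed

lemma mono_of_in_monomial_span [simp]: "mono_of u \<in> monomial_span U \<longleftrightarrow> u \<in> U"
  by (simp add: monomial_span_def mono_of_eq_single)

lemma mono_of_eq_iff [simp]: "mono_of u = (mono_of v :: ('n::finite, 'k::field) mpoly) \<longleftrightarrow> u = v"
  by (metis mono_of_in_monomial_span singletonD singletonI)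

lemma monomial_span_subset_iff:
  "(monomial_span U :: ('n::finite, 'k::field) mpoly set) \<subseteq> monomial_span V \<longleftrightarrow> U \<subseteq> V"
proof
  assume "(monomial_span U :: ('n, 'k) mpoly set) \<subseteq> monomial_span V"
  then show "U \<subseteq> V" by (metis mono_of_in_monomial_span subset_iff)
qed (auto simp: monomial_span_def)

lemma monomial_span_eq_iff:
  "(monomial_span U :: ('n::finite, 'k::field) mpoly set) = monomial_span V \<longleftrightarrow> U = V"
  by (simp add: set_eq_subset monomial_span_subset_iff)

lemma monomial_span_Inter: "monomial_span (\<Inter>(P ` B)) = (\<Inter>b\<in>B. monomial_span (P b))"
  by (auto simp: monomial_span_def)

text \<open>
  Multiplication by a polynomial only moves exponents upwards.
\<close>

lemma subspace_monomial_span: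
  assumes "up_set U"
  shows "ideal.subspace (monomial_span U :: ('n::finite, 'k::field) mpoly set)"
proof (rule ideal.subspaceI)
  fix f g :: "('n, 'k) mpoly"
  assume "f \<in> monomial_span U" "g \<in> monomial_span U"
  then show "f + g \<in> monomial_span U"
    using keys_add[of f g] by (auto simp: monomial_span_def)
next
  fix c f :: "('n, 'k) mpoly"
  assume f: "f \<in> monomial_span U"
  show "c * f \<in> monomial_span U"
    unfolding monomial_span_def
  proof (clarify)
    fix m assume "m \<in> keys (c * f)"
    then obtain p q where "q \<in> keys f" "m = p + q" using keys_mult by blast
    then have "lookup q \<in> U" "lookup q \<le> lookup m"
      using f by (auto simp: monomial_span_def le_fun_def lookup_add)
    then show "lookup m \<in> U" using assms up_setD by blast
  qed
qed (simp add: monomial_span_def)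

lemma poly_mapping_eq_sum_single: "f = (\<Sum>m\<in>keys f. Poly_Mapping.single m (lookup f m))"
  by (rule poly_mapping_eqI) (simp add: lookup_sum lookup_single when_def in_keys_iff)

lemma span_mono_of_image:
  "ideal.span (mono_of ` B) = (monomial_span (up_closure B) :: ('n::finite, 'k::field) mpoly set)"
proof
  show "ideal.span (mono_of ` B) \<subseteq> (monomial_span (up_closure B) :: ('n, 'k) mpoly set)"
    by (intro ideal.span_minimal subspace_monomial_span up_set_up_closure)
       (auto simp: up_closure_def)
  show "(monomial_span (up_closure B) :: ('n, 'k) mpoly set) \<subseteq> ideal.span (mono_of ` B)"
  proof
    fix f :: "('n, 'k) mpoly" assume f: "f \<in> monomial_span (up_closure B)"
    have "Poly_Mapping.single m c \<in> ideal.span (mono_of ` B)" if m: "m \<in> keys f" for m and c :: 'k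
    proof -
      obtain b where b: "b \<in> B" "b \<le> lookup m"
        using m f by (auto simp: monomial_span_def up_closure_def)
      have "Abs_poly_mapping (lookup m - b) + Abs_poly_mapping b = m"
        using b(2) by (intro poly_mapping_eqI) (simp add: lookup_add le_fun_def)
      then have "Poly_Mapping.single m c
        = Poly_Mapping.single (Abs_poly_mapping (lookup m - b)) c * mono_of b"
        by (simp add: mono_of_eq_single mult_single)
      also have "\<dots> \<in> ideal.span (mono_of ` B)"
        using b(1) by (intro ideal.span_scale ideal.span_base) auto
      finally show ?thesis .
    qed
    then have "(\<Sum>m\<in>keys f. Poly_Mapping.single m (lookup f m)) \<in> ideal.span (mono_of ` B)"
      by (intro ideal.span_sum)
    then show "f \<in> ideal.span (mono_of ` B)"
      using poly_mapping_eq_sum_single[of f] by simp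
  qed
qed

lemma monomial_ideal_iff:
  "monomial_ideal I \<longleftrightarrow> (\<exists>U. up_set U \<and> I = monomial_span U)"
proof
  assume "monomial_ideal I"
  then obtain M where "M \<subseteq> range mono_of" "I = ideal.span M" by (auto simp: monomial_ideal_def)
  moreover then obtain B where "M = mono_of ` B" by (auto simp: subset_image_iff)
  ultimately show "\<exists>U. up_set U \<and> I = monomial_span U"
    using span_mono_of_image up_set_up_closure by blast
next
  assume "\<exists>U. up_set U \<and> I = monomial_span U"
  then obtain U where "up_set U" "I = monomial_span U" by blast
  then have "I = ideal.span (mono_of ` minimals U)"
    by (simp add: span_mono_of_image up_closure_minimals)
  then show "monomial_ideal I"
    unfolding monomial_ideal_def by (intro exI[of _ "mono_of ` minimals U"]) auto
qed

lemma var_power_ideal_eq: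
  "(var_power_ideal b :: ('n::finite, 'k::field) mpoly set) = monomial_span (power_exponents b)"
proof -
  have "{Var i ^ b i |i. b i \<ge> 1} 
      = (mono_of ` {(\<lambda>_. 0)(i := b i) | i. b i \<ge> 1} :: ('n, 'k) mpoly set)"
    by (auto simp: Var_power_eq_mono_of)
  moreover have "up_closure {(\<lambda>_. 0)(i := b i) | i. b i \<ge> 1} = power_exponents b"
    by (auto simp: up_closure_def power_exponents_def le_fun_def split: if_splits)
  ultimately show ?thesis unfolding var_power_ideal_def by (simp only: span_mono_of_image)
qed

lemma var_power_ideal_eq_iff:
  "var_power_ideal b = (var_power_ideal c :: ('n::finite, 'k::field) mpoly set) \<longleftrightarrow> b = c"
  by (simp add: var_power_ideal_eq monomial_span_eq_iff power_exponents_eq_iff)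

text \<open>
  Every set of monomials that generates the ideal contains the minimal ones, so the minimal
  monomials form not just a minimal but the least generating set.
\<close>

lemma min_gens_monomial_span:
  assumes "up_set U"
  shows "min_gens (monomial_span U :: ('n::finite, 'k::field) mpoly set) = mono_of ` minimals U"
  unfolding min_gens_def
proof (rule the_equality)
  let ?I = "monomial_span U :: ('n, 'k) mpoly set"
  have contains: "mono_of ` minimals U \<subseteq> H"
    if "H \<subseteq> range mono_of" "ideal.span H = ?I" for H :: "('n, 'k) mpoly set"
  proof -
    obtain B where B: "H = mono_of ` B" using \<open>H \<subseteq> range mono_of\<close> by (auto simp: subset_image_iff)
    then have "up_closure B = U"
      using that(2) by (simp add: span_mono_of_image monomial_span_eq_iff)
    then show ?thesis using minimals_up_closure_subset B by blast
  qed
  have gen: "ideal.span (mono_of ` minimals U) = ?I"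
    using assms by (simp add: span_mono_of_image up_closure_minimals)
  have "ideal.span H \<noteq> ?I" if H: "H \<subset> mono_of ` minimals U" for H
  proof
    assume "ideal.span H = ?I"
    moreover have "H \<subseteq> range mono_of" using H by auto
    ultimately show False using contains[of H] H by auto
  qed
  with gen show "mono_of ` minimals U \<subseteq> range mono_of \<and> ideal.span (mono_of ` minimals U) = ?I \<and>
      (\<forall>H. H \<subset> mono_of ` minimals U \<longrightarrow> ideal.span H \<noteq> ?I)"
    by auto
  fix G :: "('n, 'k) mpoly set"
  assume "G \<subseteq> range mono_of \<and> ideal.span G = ?I \<and> (\<forall>H. H \<subset> G \<longrightarrow> ideal.span H \<noteq> ?I)"
  then show "G = mono_of ` minimals U" using contains[of G] gen by (metis psubsetI)
qed

lemma lcm_exponent_le_iff: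
  assumes "up_set U"
  shows "lcm_exponent (monomial_span U :: ('n::finite, 'k::field) mpoly set) \<le> a
    \<longleftrightarrow> minimals U \<subseteq> {..a}"
proof -
  have "{b i |b. b \<in> minimals U} = (\<lambda>b. b i) ` minimals U" for i by auto
  moreover have "mono_of b \<in> (mono_of ` minimals U :: ('n, 'k) mpoly set) \<longleftrightarrow> b \<in> minimals U" for b
    by auto
  ultimately show ?thesis
    by (auto simp: lcm_exponent_def min_gens_monomial_span[OF assms] le_fun_def finite_minimals)
qed

section \<open>The ideals generated by powers of variables are irreducible\<close>

text \<open>
  For a monomial order, the sum of the leading exponents of two polynomials arises only once as a
  sum of exponents. In place of a monomial order, which would need an order on the variables, the two
  sets are narrowed down to the elements with maximal \<open>x\<close>-th coordinate, for one variable \<open>x\<close> after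
  the other.
\<close>

lemma unique_sum:
  fixes A B :: "('n::finite \<Rightarrow>\<^sub>0 nat) set"
  assumes "finite A" "A \<noteq> {}" "finite B" "B \<noteq> {}"
  obtains p q where "p \<in> A" "q \<in> B"
    "\<And>p' q'. p' \<in> A \<Longrightarrow> q' \<in> B \<Longrightarrow> p' + q' = p + q \<Longrightarrow> p' = p \<and> q' = q"
proof -
  have "\<exists>p\<in>A. \<exists>q\<in>B. \<forall>p'\<in>A. \<forall>q'\<in>B. p' + q' = p + q \<longrightarrow>
          (\<forall>i\<in>X. lookup p' i = lookup p i \<and> lookup q' i = lookup q i)"
    if "finite X" for X :: "'n set"
    using that assms
  proof (induction X arbitrary: A B)
    case empty
    then show ?case by auto
  next
    case (insert x X)
    define a where "a = Max ((\<lambda>p. lookup p x) ` A)"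
    define b where "b = Max ((\<lambda>p. lookup p x) ` B)"
    define A' where "A' = {p \<in> A. lookup p x = a}"
    define B' where "B' = {p \<in> B. lookup p x = b}"
    have "a \<in> (\<lambda>p. lookup p x) ` A" "b \<in> (\<lambda>p. lookup p x) ` B"
      unfolding a_def b_def using insert.prems by (auto intro!: Max_in)
    then have "A' \<noteq> {}" "B' \<noteq> {}" by (auto simp: A'_def B'_def)
    moreover have "finite A'" "finite B'" using insert.prems by (auto simp: A'_def B'_def)
    ultimately have "\<exists>p\<in>A'. \<exists>q\<in>B'. \<forall>p'\<in>A'. \<forall>q'\<in>B'. p' + q' = p + q \<longrightarrow>
          (\<forall>i\<in>X. lookup p' i = lookup p i \<and> lookup q' i = lookup q i)"
      by (intro insert.IH)
    then obtain p q where pq: "p \<in> A'" "q \<in> B'"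
      "\<forall>p'\<in>A'. \<forall>q'\<in>B'. p' + q' = p + q \<longrightarrow>
          (\<forall>i\<in>X. lookup p' i = lookup p i \<and> lookup q' i = lookup q i)" by blast
    have top: "p' \<in> A' \<and> q' \<in> B'" if "p' \<in> A" "q' \<in> B" "p' + q' = p + q" for p' q'
    proof -
      have "lookup p' x \<le> a" "lookup q' x \<le> b"
        unfolding a_def b_def using that insert.prems by auto
      moreover have "lookup p' x + lookup q' x = a + b"
        using arg_cong[OF that(3), of "\<lambda>m. lookup m x"] pq(1,2)
        by (simp add: A'_def B'_def lookup_add)
      ultimately have "lookup p' x = a \<and> lookup q' x = b" by linarith
      then show ?thesis using that by (simp add: A'_def B'_def)
    qed
    have "\<forall>i\<in>insert x X. lookup p' i = lookup p i \<and> lookup q' i = lookup q i"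
      if "p' \<in> A" "q' \<in> B" "p' + q' = p + q" for p' q'
    proof -
      have "lookup p' x = lookup p x \<and> lookup q' x = lookup q x"
        using top[OF that] pq(1,2) by (simp add: A'_def B'_def)
      then show ?thesis using pq(3) top[OF that] that(3) by blast
    qed
    moreover have "p \<in> A" "q \<in> B" using pq(1,2) by (simp_all add: A'_def B'_def)
    ultimately show ?case by blast
  qed
  from this[of UNIV] obtain p q where "p \<in> A" "q \<in> B" "\<forall>p'\<in>A. \<forall>q'\<in>B. p' + q' = p + q \<longrightarrow>
          (\<forall>i. lookup p' i = lookup p i \<and> lookup q' i = lookup q i)" by auto
  then show ?thesis by (intro that[of p q]) (auto intro: poly_mapping_eqI)
qed

text \<open>
  The coefficient at a uniquely represented sum of exponents is a product of two nonzero
  coefficients.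
\<close>

lemma mpoly_no_zero_divisors:
  fixes f g :: "('n::finite, 'k::field) mpoly"
  assumes "f \<noteq> 0" "g \<noteq> 0"
  shows "f * g \<noteq> 0"
proof -
  obtain p q where pq: "p \<in> keys f" "q \<in> keys g"
    "\<And>p' q'. p' \<in> keys f \<Longrightarrow> q' \<in> keys g \<Longrightarrow> p' + q' = p + q \<Longrightarrow> p' = p \<and> q' = q"
    using unique_sum[of "keys f" "keys g"] assms by auto
  have "f * g = (\<Sum>l\<in>keys f. \<Sum>r\<in>keys g. Poly_Mapping.single (l + r) (lookup f l * lookup g r))"
    by (subst (1) poly_mapping_eq_sum_single[of f], subst (1) poly_mapping_eq_sum_single[of g])
       (simp add: sum_product mult_single)
  then have "lookup (f * g) (p + q)
      = (\<Sum>l\<in>keys f. \<Sum>r\<in>keys g. if l + r = p + q then lookup f l * lookup g r else 0)"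
    by (simp add: lookup_sum lookup_single when_def)
  also have "\<dots> = (\<Sum>l\<in>keys f. \<Sum>r\<in>keys g. if l = p \<and> r = q then lookup f p * lookup g q else 0)"
    using pq(3) by (intro sum.cong refl) auto
  also have "\<dots> = (\<Sum>l\<in>keys f. if l = p then lookup f p * lookup g q else 0)"
    using pq(2) by (intro sum.cong refl) auto
  also have "\<dots> = lookup f p * lookup g q" using pq(1) by simp
  also have "\<dots> \<noteq> 0" using pq by (simp add: in_keys_iff)
  finally show ?thesis by auto
qed

text \<open>
  Modulo \<open>\<mm>\<^sup>b\<close>, the polynomials \<open>x\<close> to the power \<open>b - 1\<close> times \<open>h\<close>, where \<open>h\<close> involves only the
  variables with \<open>b i = 0\<close>, play the role of the socle: every nonzero ideal contains a nonzero one. To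
  find it, take an element \<open>f\<close> of the ideal outside \<open>\<mm>\<^sup>b\<close>, and among its exponents outside \<open>\<mm>\<^sup>b\<close> one,
  \<open>u\<close>, of least degree in the variables with \<open>b i \<ge> 1\<close>. The monomial that lifts \<open>u\<close> to \<open>b - 1\<close> in
  these variables moves every other exponent into \<open>\<mm>\<^sup>b\<close>, except those that agree with \<open>u\<close> there. On
  the variables with \<open>b i = 0\<close> the truncated subtraction \<open>b i - 1\<close> gives \<open>0\<close>, as it should.
\<close>

lemma socle_multiple:
  fixes b :: "'n::finite \<Rightarrow> nat" and J :: "('n, 'k::field) mpoly set"
  assumes J: "ideal.subspace J" "var_power_ideal b \<subseteq> J" "J \<noteq> var_power_ideal b"
  obtains h where "h \<noteq> 0" "\<And>m i. m \<in> keys h \<Longrightarrow> 1 \<le> b i \<Longrightarrow> lookup m i = 0"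
    "mono_of (\<lambda>i. b i - 1) * h \<in> J"
proof -
  let ?V = "power_exponents b"
  let ?t = "Abs_poly_mapping (\<lambda>i. b i - 1)"
  obtain f where f: "f \<in> J" "f \<notin> monomial_span ?V"
    using J(2,3) by (auto simp: var_power_ideal_eq)
  define R where "R = {m \<in> keys f. lookup m \<notin> ?V}"
  have "R \<noteq> {}" using f(2) by (auto simp: R_def monomial_span_def)
  define size where "size m = (\<Sum>i | 1 \<le> b i. lookup m i)" for m :: "'n \<Rightarrow>\<^sub>0 nat"
  obtain u where u: "u \<in> R" "\<And>m. m \<in> R \<Longrightarrow> size u \<le> size m"
    using \<open>R \<noteq> {}\<close> ex_has_least_nat[of "\<lambda>m. m \<in> R" _ size] by blast
  have u_less: "lookup u i < b i" if "1 \<le> b i" for i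
    using u(1) that unfolding R_def not_mem_power_exponents_iff by blast
  define s where "s = Abs_poly_mapping (\<lambda>i. b i - 1 - (if 1 \<le> b i then lookup u i else 0))"
  \<comment> \<open>An exponent that stays outside is at most \<open>u\<close> in the relevant variables, hence equal to \<open>u\<close>
      there by the choice of \<open>u\<close>.\<close>
  have outside: "lookup m i = lookup u i"
    if m: "m \<in> keys f" "lookup (s + m) \<notin> ?V" and i: "1 \<le> b i" for m i
  proof -
    have le: "lookup m j \<le> lookup u j" if "1 \<le> b j" for j
    proof -
      have "lookup (s + m) j < b j"
        using m(2) that unfolding not_mem_power_exponents_iff by blast
      then show ?thesis using that u_less[OF that] by (simp add: lookup_add s_def)
    qed
    have "lookup m \<notin> ?V"
      unfolding not_mem_power_exponents_iff using le u_less by (blast intro: le_less_trans)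
    then have "size u \<le> size m" using m u(2) by (simp add: R_def)
    show ?thesis
    proof (rule ccontr)
      assume "lookup m i \<noteq> lookup u i"
      with le[OF i] have "lookup m i < lookup u i" by simp
      then have "size m < size u"
        unfolding size_def using le i by (intro sum_strict_mono_ex1) auto
      with \<open>size u \<le> size m\<close> show False by simp
    qed
  qed
  \<comment> \<open>The terms in \<open>low\<close> survive modulo \<open>\<mm>\<^sup>b\<close>; dividing them by the common monomial gives \<open>h\<close>.\<close>
  define low where "low = {m \<in> keys f. lookup (s + m) \<notin> ?V}"
  define h where "h = (\<Sum>m\<in>low. Poly_Mapping.single (s + m - ?t) (lookup f m))"
  have shift: "?t + (s + m - ?t) = s + m" if "m \<in> low" for m
  proof (rule poly_mapping_eqI)
    fix i
    show "lookup (?t + (s + m - ?t)) i = lookup (s + m) i"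
      using outside[of m i] that u_less[of i]
      by (cases "1 \<le> b i") (auto simp: low_def lookup_add lookup_minus s_def)
  qed
  have h: "mono_of (\<lambda>i. b i - 1) * h = (\<Sum>m\<in>low. Poly_Mapping.single (s + m) (lookup f m))"
  proof -
    have "mono_of (\<lambda>i. b i - 1) * h
        = (\<Sum>m\<in>low. Poly_Mapping.single (?t + (s + m - ?t)) (lookup f m))"
      by (simp add: h_def sum_distrib_left mono_of_eq_single mult_single)
    also have "\<dots> = (\<Sum>m\<in>low. Poly_Mapping.single (s + m) (lookup f m))"
      by (intro sum.cong refl) (simp only: shift)
    finally show ?thesis .
  qed
  have "Poly_Mapping.single s 1 * f = (\<Sum>m\<in>keys f. Poly_Mapping.single (s + m) (lookup f m))"
    by (subst (1) poly_mapping_eq_sum_single[of f]) (simp add: sum_distrib_left mult_single)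
  also have "\<dots> = mono_of (\<lambda>i. b i - 1) * h
      + (\<Sum>m\<in>keys f - low. Poly_Mapping.single (s + m) (lookup f m))"
    unfolding h by (subst sum.subset_diff[of low "keys f"]) (simp_all add: low_def)
  finally have split: "mono_of (\<lambda>i. b i - 1) * h = Poly_Mapping.single s 1 * f
      - (\<Sum>m\<in>keys f - low. Poly_Mapping.single (s + m) (lookup f m))" by simp
  have "Poly_Mapping.single (s + m) (lookup f m) \<in> monomial_span ?V" if "m \<in> keys f - low" for m
    using that by (auto simp: low_def monomial_span_def)
  then have "(\<Sum>m\<in>keys f - low. Poly_Mapping.single (s + m) (lookup f m)) \<in> monomial_span ?V"
    by (intro ideal.subspace_sum subspace_monomial_span up_set_power_exponents)
  then have "mono_of (\<lambda>i. b i - 1) * h \<in> J"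
    unfolding split using J(1,2) f(1)
    by (intro ideal.subspace_diff ideal.subspace_scale) (auto simp: var_power_ideal_eq)
  moreover have "lookup m i = 0" if m: "m \<in> keys h" and i: "1 \<le> b i" for m i
  proof -
    have "m \<in> (\<Union>m'\<in>low. keys (Poly_Mapping.single (s + m' - ?t) (lookup f m')))"
      using m unfolding h_def by (rule subsetD[OF keys_sum])
    then obtain m' where m': "m' \<in> low" "m = s + m' - ?t" by (auto split: if_splits)
    then show ?thesis
      using outside[of m' i] i u_less[of i] by (simp add: low_def lookup_minus lookup_add s_def)
  qed
  moreover have "h \<noteq> 0"
  proof
    assume "h = 0"
    have "lookup (s + u) i < b i" if "1 \<le> b i" for i
      using that u_less[of i] by (simp add: lookup_add s_def)
    then have "lookup (s + u) \<notin> ?V" unfolding not_mem_power_exponents_iff by blast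
    then have "u \<in> low" using u(1) by (simp add: low_def R_def)
    have "0 = lookup (mono_of (\<lambda>i. b i - 1) * h) (s + u)" using \<open>h = 0\<close> by simp
    also have "\<dots> = lookup f u"
      unfolding h using \<open>u \<in> low\<close> by (simp add: lookup_sum lookup_single when_def low_def)
    finally show False using u(1) by (simp add: R_def in_keys_iff)
  qed
  ultimately show ?thesis using that by blast
qed

text \<open>
  If \<open>J\<close> and \<open>K\<close> both contained \<open>\<mm>\<^sup>b\<close> strictly, they would contain \<open>x\<close> to the power \<open>b - 1\<close> times \<open>f\<close>
  and times \<open>g\<close>, respectively, with \<open>f\<close> and \<open>g\<close> nonzero polynomials in the variables with
  \<open>b i = 0\<close>. Then \<open>J \<inter> K\<close> contains the same monomial times \<open>f * g\<close>. This is not in \<open>\<mm>\<^sup>b\<close>, because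
  \<open>f * g\<close> is nonzero and its exponents vanish where \<open>b i \<ge> 1\<close>.
\<close>

lemma irreducible_var_power_ideal:
  "irreducible_ideal (var_power_ideal b :: ('n::finite, 'k::field) mpoly set)"
  unfolding irreducible_ideal_def
proof (intro conjI allI impI)
  let ?V = "var_power_ideal b :: ('n, 'k) mpoly set"
  let ?x = "mono_of (\<lambda>i. b i - 1) :: ('n, 'k) mpoly"
  show "ideal.subspace ?V" by (simp add: var_power_ideal_def)
  have "mono_of (\<lambda>_. 0) \<notin> ?V" by (simp add: var_power_ideal_eq power_exponents_def)
  then show "?V \<noteq> UNIV" by auto
  fix J K :: "('n, 'k) mpoly set"
  assume J: "ideal.subspace J" and K: "ideal.subspace K" and JK: "?V = J \<inter> K"
  show "?V = J \<or> ?V = K"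
  proof (rule ccontr)
    assume "\<not> (?V = J \<or> ?V = K)"
    then obtain f g where
      f: "f \<noteq> 0" "\<And>m i. m \<in> keys f \<Longrightarrow> 1 \<le> b i \<Longrightarrow> lookup m i = 0" "?x * f \<in> J" and
      g: "g \<noteq> 0" "\<And>m i. m \<in> keys g \<Longrightarrow> 1 \<le> b i \<Longrightarrow> lookup m i = 0" "?x * g \<in> K"
      using socle_multiple[of J b] socle_multiple[of K b] J K JK
      by (metis Int_lower1 Int_lower2)
    have "g * (?x * f) = ?x * (f * g)" by (simp only: mult.left_commute[of g] mult.commute[of g f])
    then have "?x * (f * g) \<in> J" using ideal.subspace_scale[OF J f(3), of g]
      by (simp only:)
    moreover have "?x * (f * g) \<in> K"
      using ideal.subspace_scale[OF K g(3), of f] by (simp only: mult.left_commute[of f])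
    ultimately have in_V: "?x * (f * g) \<in> ?V" using JK by blast
    have "f * g \<noteq> 0" using f(1) g(1) mpoly_no_zero_divisors by blast
    moreover have keys_x: "keys ?x = {Abs_poly_mapping (\<lambda>i. b i - 1)}"
      by (simp add: mono_of_eq_single)
    then have "?x \<noteq> 0" by (metis insert_not_empty keys_zero)
    ultimately have "?x * (f * g) \<noteq> 0" using mpoly_no_zero_divisors by blast
    then have "keys (?x * (f * g)) \<noteq> {}" by (simp only: keys_eq_empty not_False_eq_True)
    then obtain m where m: "m \<in> keys (?x * (f * g))" by blast
    then obtain q where q: "m = Abs_poly_mapping (\<lambda>i. b i - 1) + q" "q \<in> keys (f * g)"
      using keys_mult[of ?x "f * g"] unfolding keys_x by blast
    have "lookup q i = 0" if "1 \<le> b i" for i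
      using q(2) keys_mult[of f g] f(2) g(2) that by (fastforce simp: lookup_add)
    then have "lookup m \<notin> power_exponents b"
      unfolding not_mem_power_exponents_iff by (simp add: q(1) lookup_add)
    then show False using in_V m unfolding var_power_ideal_eq monomial_span_def by blast
  qed
qed

section \<open>Irreducible decompositions\<close>

lemma Inter_var_power_ideals:
  "\<Inter>(var_power_ideal ` B)
    = (monomial_span (\<Inter>(power_exponents ` B)) :: ('n::finite, 'k::field) mpoly set)"
  by (simp add: monomial_span_Inter var_power_ideal_eq)

lemma monomial_span_eq_Inter_var_power_ideals:
  fixes U :: "('n::finite \<Rightarrow> nat) set"
  assumes "up_set U" "minimals U \<subseteq> {..a}"
  obtains B where "B \<subseteq> {..a}" "finite B"
    "monomial_span U = \<Inter>(var_power_ideal ` B :: ('n, 'k::field) mpoly set set)"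
proof
  let ?B = "{b. b \<le> a \<and> U \<subseteq> power_exponents b}"
  show "?B \<subseteq> {..a}" by auto
  have "finite {..a}"
  proof -
    have "{..a} \<subseteq> Pi\<^sub>E UNIV (\<lambda>i. {..a i})" by (auto simp: le_fun_def PiE_UNIV_domain)
    then show ?thesis by (rule finite_subset) (simp add: finite_PiE)
  qed
  then show "finite ?B" by (rule rev_finite_subset) auto
  show "monomial_span U = \<Inter>(var_power_ideal ` ?B :: ('n, 'k) mpoly set set)"
    using up_set_eq_Inter_power_exponents[OF assms] by (simp add: Inter_var_power_ideals)
qed

lemma irreducible_ideal_Inter:
  assumes "finite D" "\<forall>J\<in>D. ideal.subspace J" "irreducible_ideal (\<Inter>D)"
  shows "\<Inter>D \<in> D"
  using assms
proof (induction D)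
  case empty
  then show ?case by (simp add: irreducible_ideal_def)
next
  case (insert J D)
  have "ideal.subspace (\<Inter>D)" using insert.prems by (intro ideal.subspace_Inter) auto
  then have "\<Inter>(insert J D) = J \<or> \<Inter>(insert J D) = \<Inter>D"
    using insert.prems unfolding irreducible_ideal_def by simp
  then show ?case using insert.IH insert.prems by auto
qed

text \<open>
  Being a finite intersection of ideals \<open>\<mm>\<^sup>b\<close>, an irreducible monomial ideal equals one of them.
\<close>

lemma irreducible_monomial_ideal:
  fixes J :: "('n::finite, 'k::field) mpoly set"
  assumes "monomial_ideal J" "irreducible_ideal J"
  obtains b where "J = var_power_ideal b"
proof -
  obtain U where U: "up_set U" "J = monomial_span U"
    using assms(1) monomial_ideal_iff by blast
  have "minimals U \<subseteq> {..lcm_exponent J}"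
    using lcm_exponent_le_iff[OF U(1)] U(2) by blast
  then obtain B where "finite B" "J = \<Inter>(var_power_ideal ` B)"
    using monomial_span_eq_Inter_var_power_ideals[OF U(1)] U(2) by metis
  then have "J \<in> var_power_ideal ` B"
    using irreducible_ideal_Inter[of "var_power_ideal ` B"] assms(2)
    by (auto simp: var_power_ideal_def)
  then show ?thesis using that by blast
qed

lemma monomial_ideal_var_power_ideal: "monomial_ideal (var_power_ideal b)"
  using monomial_ideal_iff var_power_ideal_eq up_set_power_exponents by blast

text \<open>
  By primeness every component in \<open>D\<close> contains one in \<open>D'\<close>, and conversely. A component \<open>J\<close> in \<open>D\<close> thus
  contains some \<open>K\<close> in \<open>D'\<close>, which contains some \<open>L\<close> in \<open>D\<close>; irredundancy of \<open>D\<close> forces \<open>L = J\<close>, hence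
  \<open>K = J\<close>.
\<close>

lemma irredundant_irr_decomp_subset:
  fixes I :: "('n::finite, 'k::field) mpoly set"
  assumes "irredundant_irr_decomp I D" "irredundant_irr_decomp I D'"
  shows "D \<subseteq> D'"
proof
  have below: "\<exists>K\<in>D'. K \<subseteq> J"
    if D: "irredundant_irr_decomp I D" and D': "irredundant_irr_decomp I D'" and J: "J \<in> D"
    for D D' :: "('n, 'k) mpoly set set" and J
  proof -
    obtain b where b: "J = var_power_ideal b"
      using D J irreducible_monomial_ideal by (auto simp: irredundant_irr_decomp_def)
    have "\<forall>K\<in>D'. \<exists>U. up_set U \<and> K = monomial_span U"
      using D' monomial_ideal_iff by (auto simp: irredundant_irr_decomp_def)
    then obtain P where P: "\<forall>K\<in>D'. up_set (P K) \<and> K = monomial_span (P K)" by metis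
    have "(\<Inter>K\<in>D'. monomial_span (P K)) = \<Inter>D'" using P by auto
    also have "\<dots> = \<Inter>D" using D D' by (simp add: irredundant_irr_decomp_def)
    also have "\<dots> \<subseteq> monomial_span (power_exponents b)"
      using J b var_power_ideal_eq by auto
    finally have "\<Inter>(P ` D') \<subseteq> power_exponents b"
      by (simp only: monomial_span_subset_iff flip: monomial_span_Inter)
    moreover have "finite D'" using D' by (simp add: irredundant_irr_decomp_def)
    ultimately obtain K where "K \<in> D'" "P K \<subseteq> power_exponents b"
      using power_exponents_prime[of "P ` D'" b] P by auto
    then show ?thesis
      using P b by (metis var_power_ideal_eq monomial_span_subset_iff)
  qed
  fix J assume J: "J \<in> D"
  obtain K where K: "K \<in> D'" "K \<subseteq> J" using below[OF assms J] by blast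
  obtain L where L: "L \<in> D" "L \<subseteq> K" using below[OF assms(2,1) K(1)] by blast
  have "L = J"
  proof (rule ccontr)
    assume "L \<noteq> J"
    then have "\<Inter>(D - {J}) = \<Inter>D" using L K by blast
    then show False using assms(1) J by (auto simp: irredundant_irr_decomp_def)
  qed
  then have "K = J" using K(2) L(2) by (simp only: subset_antisym)
  then show "J \<in> D'" using K(1) by simp
qed

text \<open>
  A decomposition with the fewest components is irredundant, and there is no other irredundant one.
  Drawing its components from the ideals \<open>\<mm>\<^sup>b\<close> with \<open>b \<le> a\<close> shows that all components of \<open>I\<close> have
  \<open>b \<le> a\<close>. The unit ideal is covered by \<open>B = {}\<close>.
\<close>

lemma Irr_monomial_span:
  fixes U :: "('n::finite \<Rightarrow> nat) set"
  assumes "up_set U" "minimals U \<subseteq> {..a}"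
  obtains B where "B \<subseteq> {..a}" "U = \<Inter>(power_exponents ` B)"
    "Irr (monomial_span U :: ('n, 'k::field) mpoly set) = var_power_ideal ` B"
proof -
  let ?I = "monomial_span U :: ('n, 'k) mpoly set"
  obtain B\<^sub>0 where B\<^sub>0: "B\<^sub>0 \<subseteq> {..a}" "finite B\<^sub>0" "?I = \<Inter>(var_power_ideal ` B\<^sub>0)"
    using monomial_span_eq_Inter_var_power_ideals[OF assms] by blast
  define P where "P D \<longleftrightarrow> D \<subseteq> var_power_ideal ` B\<^sub>0 \<and> \<Inter>D = ?I" for D
  have "P (var_power_ideal ` B\<^sub>0)" using B\<^sub>0(3) by (simp add: P_def)
  then obtain D where D: "P D" and least: "\<And>D'. P D' \<Longrightarrow> card D \<le> card D'"
    using ex_has_least_nat[of P _ card] by blast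
  have fin: "finite D" using D B\<^sub>0(2) by (auto simp: P_def intro: finite_surj)
  have "\<Inter>(D - {J}) \<noteq> ?I" if "J \<in> D" for J
  proof
    assume "\<Inter>(D - {J}) = ?I"
    then have "P (D - {J})" using D by (auto simp: P_def)
    from least[OF this] show False
      using card_Diff1_less[OF fin that] by simp
  qed
  moreover obtain B where B: "B \<subseteq> B\<^sub>0" "D = var_power_ideal ` B"
    using D by (auto simp: P_def subset_image_iff)
  moreover have "\<Inter>D = ?I" using D by (simp add: P_def)
  ultimately have irr: "irredundant_irr_decomp ?I D"
    using fin monomial_ideal_var_power_ideal irreducible_var_power_ideal
    by (auto simp only: irredundant_irr_decomp_def)
  have "Irr ?I = D"
    unfolding Irr_def
    using irr irredundant_irr_decomp_subset by (intro the_equality irr subset_antisym) auto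
  moreover have "U = \<Inter>(power_exponents ` B)"
  proof -
    have "monomial_span (\<Inter>(power_exponents ` B)) = ?I"
      using \<open>\<Inter>D = ?I\<close> B(2) by (simp only: Inter_var_power_ideals)
    then show ?thesis by (simp only: monomial_span_eq_iff)
  qed
  ultimately show ?thesis using that[of B] B B\<^sub>0(1) by auto
qed

section \<open>Alexander duality\<close>

text \<open>
  In the box \<open>[0, a]\<close> the dual is the reflected complement. The bound on the minimal elements is part
  of the conclusion so that the dual can be formed a second time; the unit ideal has to be
  admitted, since it is the dual of the zero ideal.
\<close>

lemma alexander_dual_monomial_span:
  fixes U :: "('n::finite \<Rightarrow> nat) set"
  assumes "up_set U" "minimals U \<subseteq> {..a}"
  obtains W where "up_set W" "minimals W \<subseteq> {..a}"
    "alexander_dual a (monomial_span U :: ('n, 'k::field) mpoly set) = monomial_span W"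
    "\<And>w. w \<le> a \<Longrightarrow> w \<in> W \<longleftrightarrow> a - w \<notin> U"
proof -
  let ?I = "monomial_span U :: ('n, 'k) mpoly set"
  obtain B where B: "B \<subseteq> {..a}" "U = \<Inter>(power_exponents ` B)" "Irr ?I = var_power_ideal ` B"
    using Irr_monomial_span[OF assms] by blast
  let ?W = "up_closure (dual_vec a ` B)"
  have "{mono_of (dual_vec a b) | b. var_power_ideal b \<in> Irr ?I}
      = (mono_of ` dual_vec a ` B :: ('n, 'k) mpoly set)"
    unfolding B(3) by (auto simp: image_iff var_power_ideal_eq_iff)
  then have "alexander_dual a ?I = monomial_span ?W"
    by (simp only: alexander_dual_def span_mono_of_image)
  moreover have "minimals ?W \<subseteq> {..a}"
    using minimals_up_closure_subset[of "dual_vec a ` B"] dual_vec_le by blast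
  moreover have "w \<in> ?W \<longleftrightarrow> a - w \<notin> U" if "w \<le> a" for w
  proof -
    have "w \<in> ?W \<longleftrightarrow> (\<exists>b\<in>B. dual_vec a b \<le> w)" by (auto simp: up_closure_def)
    also have "\<dots> \<longleftrightarrow> (\<exists>b\<in>B. a - w \<notin> power_exponents b)"
      using dual_vec_le_iff[OF _ that] B(1) by (intro bex_cong refl) blast
    finally show ?thesis using B(2) by blast
  qed
  ultimately show ?thesis using that up_set_up_closure by blast
qed

theorem corollary2p14:
  fixes I :: "('n::finite, 'k::field) mpoly set" and a :: "'n \<Rightarrow> nat"
  assumes "CARD('n) \<ge> 2"
    and "monomial_ideal I" and "I \<noteq> UNIV"
    and "lcm_exponent I \<le> a"
  shows "alexander_dual a (alexander_dual a I) = I \<and>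
    (\<forall>b. (\<lambda>_. 0) \<le> b \<longrightarrow> b \<le> a \<longrightarrow> dual_vec a (dual_vec a b) = b) \<and>
    alexander_dual a I = \<Inter>{var_power_ideal (dual_vec a b) | b. mono_of b \<in> min_gens I}"
proof (intro conjI)
  obtain U where U: "up_set U" "I = monomial_span U"
    using assms(2) monomial_ideal_iff by blast
  have bound: "minimals U \<subseteq> {..a}"
    using assms(4) lcm_exponent_le_iff[OF U(1)] U(2) by blast
  obtain W where W: "up_set W" "minimals W \<subseteq> {..a}" "alexander_dual a I = monomial_span W"
      "\<And>w. w \<le> a \<Longrightarrow> w \<in> W \<longleftrightarrow> a - w \<notin> U"
    using alexander_dual_monomial_span[OF U(1) bound, where 'k = 'k] U(2) by metis
  obtain W' where W': "up_set W'" "minimals W' \<subseteq> {..a}"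
      "alexander_dual a (monomial_span W :: ('n, 'k) mpoly set) = monomial_span W'"
      "\<And>w. w \<le> a \<Longrightarrow> w \<in> W' \<longleftrightarrow> a - w \<notin> W"
    using alexander_dual_monomial_span[OF W(1,2), where 'k = 'k] by metis
  have complement_le: "a - w \<le> a" for w :: "'n \<Rightarrow> nat" by (simp add: le_fun_def)
  have complement: "a - (a - w) = w" if "w \<le> a" for w :: "'n \<Rightarrow> nat"
    using that by (auto simp: le_fun_def)
  have "w \<in> W' \<longleftrightarrow> w \<in> U" for w
  proof -
    \<comment> \<open>Two complements and two reflections cancel.\<close>
    have "inf w a \<in> W' \<longleftrightarrow> inf w a \<in> U"
      using W'(4)[of "inf w a"] W(4)[OF complement_le, of "inf w a"] complement[of "inf w a"]
      by simp
    then show ?thesis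
      using truncate_mem[OF U(1) bound] truncate_mem[OF W'(1,2)] by blast
  qed
  then show "alexander_dual a (alexander_dual a I) = I"
    using W(3) W'(3) U(2) by (metis subsetI subset_antisym)
  show "\<forall>b. (\<lambda>_. 0) \<le> b \<longrightarrow> b \<le> a \<longrightarrow> dual_vec a (dual_vec a b) = b"
    by (simp add: dual_vec_dual_vec)
  have "W = \<Inter>(power_exponents ` dual_vec a ` minimals U)"
  proof (rule set_eqI)
    fix w
    let ?w = "inf w a"
    have "w \<in> W \<longleftrightarrow> a - ?w \<notin> up_closure (minimals U)"
      using truncate_mem[OF W(1,2)] W(4)[of ?w] up_closure_minimals[OF U(1)] by simp
    also have "\<dots> \<longleftrightarrow> (\<forall>b\<in>minimals U. \<not> b \<le> a - ?w)" by (auto simp: up_closure_def)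
    also have "\<dots> \<longleftrightarrow> (\<forall>b\<in>minimals U. ?w \<in> power_exponents (dual_vec a b))"
      using bound mem_power_exponents_dual_iff[of _ a ?w] by (intro ball_cong refl) auto
    also have "\<dots> \<longleftrightarrow> w \<in> \<Inter>(power_exponents ` dual_vec a ` minimals U)"
      by (simp add: truncate_mem_power_exponents dual_vec_le)
    finally show "w \<in> W \<longleftrightarrow> w \<in> \<Inter>(power_exponents ` dual_vec a ` minimals U)" .
  qed
  then have "alexander_dual a I = \<Inter>(var_power_ideal ` dual_vec a ` minimals U)"
    unfolding W(3) by (simp only: Inter_var_power_ideals)
  also have "var_power_ideal ` dual_vec a ` minimals U
      = {var_power_ideal (dual_vec a b) | b. mono_of b \<in> min_gens I}"
    unfolding U(2) min_gens_monomial_span[OF U(1)] by (auto simp: image_iff)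
  finally show "alexander_dual a I
      = \<Inter>{var_power_ideal (dual_vec a b) | b. mono_of b \<in> min_gens I}" .
qed

end
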